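(* For polynomials $P_n(x)$, $P_m(x)$ in the set $\{P_n(x): n=2,3,4,\ldots\}$, it holds $$\int_{-1}^1\frac{P_n(x)P_m(x)}{\sqrt{1-x^2}}\,dx=\begin{cases}\frac{\pi}{4}, & m=n,\\ -\frac{\pi}{8}, & |n-m|=2,\\ 0, & \text{otherwise.}\end{cases}$$
   Context: For integers $n,k\ge 0$ let $$f(n,k,2,2)=\sum_{i=0}^n(-1)^i\binom{n}{i}\binom{2n+2-2i}{n+k},$$ where $\binom{a}{b}=0$ for $b>a\ge 0$, and put $f(n,k,2,2)=0$ if $n<0$. For $n\ge 2$ and $0\le k\le n$ let $c(n,k,2,2)=(-1)^{\frac{n-k}{2}}f\left(\frac{n+k-4}{2},\frac{n-k}{2},2,2\right)$ if $n$ and $k$ have the same parity, and $c(n,k,2,2)=0$ otherwise. The polynomial $P_n(x)$ is $P_n(x)=P_{n,2,2}(x)=\sum_{k=0}^n c(n,k,2,2)x^k$, $n\ge 2$. For example $P_2(x)=x^2$, $P_3(x)=2x^3-2x$, $P_4(x)=4x^4-5x^2+1$.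
   Formalization: The value π/4 for m = n is false when n = m = 2, since P_2(x) = x² and the integral of x⁴/√(1−x²) over [−1,1] is 3π/8; the formal theorem gives 3π/8 for that pair and the stated values for all others. *)

theory Defs
  imports "HOL-Analysis.Analysis" "HOL-Computational_Algebra.Polynomial"
begin

definition f22 :: "int \<Rightarrow> nat \<Rightarrow> int" where
  "f22 n k = (if n < 0 then 0 else
     (\<Sum>i = 0..nat n. (-1) ^ i * int (nat n choose i)
        * int ((2 * nat n + 2 - 2 * i) choose (nat n + k))))"

text \<open>The first argument of \<open>f22\<close> below is \<open>-1\<close> for \<open>n = 2\<close>, \<open>k = 0\<close>, so it has
  to be computed in the integers. The truncated difference \<open>n - k\<close> is used for \<open>k \<le> n\<close> only.\<close>

definition c22 :: "nat \<Rightarrow> nat \<Rightarrow> int" where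
  "c22 n k = (if even n = even k
     then (-1) ^ ((n - k) div 2) * f22 ((int n + int k - 4) div 2) ((n - k) div 2)
     else 0)"

definition P22 :: "nat \<Rightarrow> real poly" where
  "P22 n = (\<Sum>k = 0..n. monom (real_of_int (c22 n k)) k)"

text \<open>The source gives the value \<open>\<pi>/4\<close> whenever \<open>m = n\<close>. This fails for
  \<open>m = n = 2\<close>: there \<open>P22 2\<close> is \<open>x\<^sup>2\<close>, and the integral of \<open>x\<^sup>4 / sqrt (1 - x\<^sup>2)\<close> over
  \<open>[-1, 1]\<close> is \<open>3\<pi>/8\<close>. The theorem therefore lists this pair as a separate case.\<close>

end

theory Submission imports Defs begin

text \<open>
  The polynomials are half-differences of Chebyshev polynomials in disguise: for \<open>n \<ge> 3\<close>,
  \<open>P\<^sub>n = (T\<^sub>n - T\<^bsub>n-2\<^esub>) / 2\<close>. Since the \<open>T\<^sub>n\<close> are orthogonal for the weight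
  \<open>1 / sqrt (1 - x\<^sup>2)\<close>, with squared norm \<open>\<pi>\<close> for \<open>n = 0\<close> and \<open>\<pi>/2\<close> otherwise, the diagonal
  integrals are \<open>(\<pi>/2 + \<pi>/2) / 4\<close>, and two polynomials whose indices differ by \<open>2\<close> share
  exactly one Chebyshev polynomial, with opposite signs, which gives \<open>-\<pi>/8\<close>. The index \<open>2\<close> is
  exceptional: \<open>P\<^sub>2 = x\<^sup>2 = (T\<^sub>2 + T\<^sub>0) / 2\<close>. As \<open>T\<^sub>0\<close> occurs in no other \<open>P\<^sub>n\<close>,
  this affects only the integral of \<open>P\<^sub>2\<^sup>2\<close>, which is \<open>(\<pi>/2 + \<pi>) / 4\<close>.

  That \<open>P\<^sub>n\<close> has this form is seen from a generating function. By the binomial theorem the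
  alternating sum \<open>f(a, b, 2, 2)\<close> is the coefficient of \<open>X\<^bsup>a+b\<^esup>\<close> in
  \<open>(1 + X)\<^sup>2 ((1 + X)\<^sup>2 - 1)\<^sup>a\<close>, and because \<open>(1 + X)\<^sup>2 - 1 = X (2 + X)\<close> it is the coefficient
  of \<open>X\<^sup>b\<close> in \<open>(1 + X)\<^sup>2 (2 + X)\<^sup>a\<close> (lemma \<open>f22_eq_coeff\<close>). Multiplication by \<open>2 + X\<close> is a
  two-term recurrence for these numbers, which translates into the Chebyshev recurrence
  \<open>P\<^bsub>n+2\<^esub> = 2x P\<^bsub>n+1\<^esub> - P\<^sub>n\<close> for \<open>n \<ge> 3\<close> (lemma \<open>P22_rec\<close>). The functions
  \<open>cos (n t)\<close> satisfy the same recurrence with \<open>x = cos t\<close>, so it remains to compare the first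
  polynomials (lemma \<open>poly_P22_cos\<close>) and to substitute \<open>x = cos t\<close> in the integral
  (lemma \<open>has_integral_cos_cos_arccos\<close>).
\<close>

section \<open>The generating function of the coefficients\<close>

definition f22_gf :: "nat \<Rightarrow> int poly" where
  "f22_gf a = [:1, 1:] ^ 2 * [:2, 1:] ^ a"

text \<open>In contrast to \<open>coeff_linear_poly_power\<close> this covers indices above the degree, which do
  occur in \<^const>\<open>f22\<close>.\<close>

lemma coeff_one_plus_X_power: "coeff ([:1, 1:] ^ n) i = (of_nat (n choose i) :: 'a :: comm_semiring_1)"
proof (cases "i \<le> n")
  case True
  thus ?thesis by (simp add: coeff_linear_poly_power)
next
  case False
  have "degree ([:1, 1 :: 'a:] ^ n) \<le> n"
    by (rule order.trans[OF degree_power_le]) simp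
  with False show ?thesis
    by (simp add: coeff_eq_0 binomial_eq_0)
qed

text \<open>The definition of \<^const>\<open>f22\<close> arises by expanding \<open>((1 + X)\<^sup>2 - 1)\<^sup>a\<close>. Factoring the base
  as \<open>X (2 + X)\<close> instead removes the alternating signs and lowers the index from \<open>a + b\<close> to
  \<open>b\<close>.\<close>

lemma f22_eq_coeff: "f22 (int a) b = coeff (f22_gf a) b"
proof -
  have sq: "[:0, 1:] * [:2, 1:] = (- 1) + ([:1, 1:] ^ 2 :: int poly)"
    by (simp add: power2_eq_square one_pCons)
  have "monom 1 a * f22_gf a = [:1, 1:] ^ 2 * ([:0, 1:] * [:2, 1:]) ^ a"
    by (simp only: f22_gf_def monom_altdef power_mult_distrib) (simp add: ac_simps)
  also have "\<dots> = [:1, 1:] ^ 2 * (\<Sum>i\<le>a. of_nat (a choose i) * (- 1) ^ i * ([:1, 1:] ^ 2) ^ (a - i))"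
    by (simp only: sq binomial_ring)
  also have "\<dots> = (\<Sum>i\<le>a. smult (int (a choose i) * (- 1) ^ i) ([:1, 1:] ^ (2 * a + 2 - 2 * i)))"
    unfolding sum_distrib_left
  proof (rule sum.cong)
    fix i assume i: "i \<in> {..a}"
    hence "2 * a + 2 - 2 * i = 2 + 2 * (a - i)"
      by simp
    hence "[:1, 1:] ^ (2 * a + 2 - 2 * i) = [:1, 1:] ^ 2 * (([:1, 1:] :: int poly) ^ 2) ^ (a - i)"
      by (simp only: power_add power_mult)
    moreover have "of_nat (a choose i) * (- 1) ^ i = [:int (a choose i) * (- 1) ^ i:]"
      by (cases "even i") (simp_all add: of_nat_poly)
    ultimately show "[:1, 1:] ^ 2 * (of_nat (a choose i) * (- 1) ^ i * ([:1, 1:] ^ 2) ^ (a - i)) =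
        smult (int (a choose i) * (- 1) ^ i) ([:1, 1:] ^ (2 * a + 2 - 2 * i))"
      by (simp add: mult.left_commute[of "[:1, 1:] ^ 2"])
  qed simp
  finally have "coeff (monom 1 a * f22_gf a) (a + b) =
      (\<Sum>i\<le>a. int (a choose i) * (- 1) ^ i * int ((2 * a + 2 - 2 * i) choose (a + b)))"
    by (simp add: coeff_sum coeff_one_plus_X_power)
  thus ?thesis
    by (simp add: coeff_monom_mult f22_def atMost_atLeast0 mult.commute[of "(- 1) ^ _"])
qed

lemma f22_gf_Suc: "f22_gf (Suc a) = [:2, 1:] * f22_gf a"
  by (simp add: f22_gf_def algebra_simps)

lemma f22_rec: "f22 (int (Suc a)) (Suc b) = 2 * f22 (int a) (Suc b) + f22 (int a) b"
  by (simp only: f22_eq_coeff f22_gf_Suc) simp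

lemma f22_rec_0: "f22 (int (Suc a)) 0 = 2 * f22 (int a) 0"
  by (simp only: f22_eq_coeff f22_gf_Suc) simp

lemma f22_eq_0: 
  assumes "b > a + 2" shows "f22 (int a) b = 0"
proof -
  have "degree (f22_gf a) \<le> 2 + a"
    unfolding f22_gf_def
    by (rule order.trans[OF degree_mult_le add_mono])
       (rule order.trans[OF degree_power_le], simp)+
  with assms show ?thesis
    by (simp only: f22_eq_coeff) (rule coeff_eq_0, simp)
qed

text \<open>In the coordinates \<open>a = (n + k - 4) / 2\<close>, \<open>b = (n - k) / 2\<close> both arguments of
  \<^const>\<open>f22\<close> are free of division and subtraction. Among the coefficients with \<open>n \<ge> 2\<close>
  and \<open>n - k\<close> even, only the one with \<open>n = 2\<close>, \<open>k = 0\<close> is not of this form, because there \<open>a = -1\<close>.\<close>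

lemma c22_eq_f22:
  assumes "n = a + b + 2" "a + 2 = b + k"
  shows "c22 n k = (-1) ^ b * f22 (int a) b"
proof -
  have "n - k = 2 * b" "int n + int k - 4 = 2 * int a" "n = k + 2 * b"
    using assms by linarith+
  thus ?thesis
    by (simp add: c22_def)
qed

section \<open>Recurrence and trigonometric form\<close>

lemma coeff_P22: "coeff (P22 n) k = (if k \<le> n then real_of_int (c22 n k) else 0)"
  by (simp add: P22_def coeff_sum)

text \<open>In the coordinates of \<open>c22_eq_f22\<close> the three coefficients have the indices
  \<open>(a + 1, b + 1)\<close>, \<open>(a, b + 1)\<close> and \<open>(a, b)\<close>, so this is \<open>f22_rec\<close> up to the signs. For
  \<open>k = 0\<close> the middle one lies beyond the degree \<open>a + 2\<close> of the generating function. The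
  bound \<open>n \<ge> 3\<close> excludes the coefficient with \<open>a = -1\<close>.\<close>

lemma c22_rec:
  assumes "n \<ge> 3" "k \<le> n"
  shows "c22 (Suc (Suc n)) k =
    (if k = 0 then 0 else 2 * c22 (Suc n) (k - 1)) - c22 n k"
proof (cases "even n = even k")
  case False
  thus ?thesis by (auto simp: c22_def)
next
  case True
  with assms obtain b where b: "n = 2 * b + k" 
    by (metis add.commute dvd_diff_nat even_add evenE le_add_diff_inverse even_diff_nat)
  hence "b + k \<ge> 2" using assms by linarith
  then obtain a where a: "a + 2 = b + k"
    by (metis add.commute le_add_diff_inverse)
  have n: "n = a + b + 2" using a b by linarith
  have 1: "c22 n k = (-1) ^ b * f22 (int a) b"
    using n a by (rule c22_eq_f22)
  have 2: "c22 (Suc (Suc n)) k = (-1) ^ Suc b * f22 (int (Suc a)) (Suc b)"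
    using c22_eq_f22[of "Suc (Suc n)" "Suc a" "Suc b" k] a by (simp add: n)
  show ?thesis
  proof (cases "k = 0")
    case True
    hence "f22 (int a) (Suc b) = 0"
      using a by (intro f22_eq_0) simp
    thus ?thesis
      using True unfolding 1 2 f22_rec by simp
  next
    case False
    have 3: "c22 (Suc n) (k - 1) = (-1) ^ Suc b * f22 (int a) (Suc b)"
      using c22_eq_f22[of "Suc n" a "Suc b" "k - 1"] a False by (simp add: n)
    show ?thesis
      using False unfolding 1 2 3 f22_rec by (simp add: algebra_simps)
  qed
qed

lemma c22_diag: "n \<ge> 2 \<Longrightarrow> c22 (Suc n) (Suc n) = 2 * c22 n n"
proof -
  assume "n \<ge> 2"
  then obtain a where n: "n = a + 2"
    by (metis add.commute le_add_diff_inverse)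
  show ?thesis
    using c22_eq_f22[of n a 0 n] c22_eq_f22[of "Suc n" "Suc a" 0 "Suc n"] f22_rec_0[of a]
    by (simp add: n)
qed

text \<open>The recurrence fails for \<open>n = 2\<close>, where the constant terms differ by \<open>1\<close>: this is the
  exceptional sign of \<open>T\<^sub>0\<close> in \<open>P\<^sub>2\<close>.\<close>

lemma P22_rec:
  assumes "n \<ge> 3"
  shows "P22 (Suc (Suc n)) = [:0, 2:] * P22 (Suc n) - P22 n"
proof (rule poly_eqI)
  fix k
  consider "k \<le> n" | "k = Suc n" | "k = Suc (Suc n)" | "k > Suc (Suc n)" by linarith
  thus "coeff (P22 (Suc (Suc n))) k = coeff ([:0, 2:] * P22 (Suc n) - P22 n) k"
  proof cases
    case 1
    thus ?thesis
      using c22_rec[OF assms 1] by (cases k) (simp_all add: coeff_P22)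
  next
    case 2
    thus ?thesis
      by (simp add: coeff_P22 c22_def)
  next
    case 3
    thus ?thesis
      using c22_diag[of "Suc n"] assms by (simp add: coeff_P22)
  next
    case 4
    thus ?thesis by (cases k) (simp_all add: coeff_P22)
  qed
qed

lemma f22_0: "f22 0 0 = 1" "f22 0 1 = 2" "f22 0 2 = 1"
  using f22_eq_coeff[of 0] by (simp_all add: f22_gf_def power2_eq_square numeral_2_eq_2)

lemma P22_2: "P22 2 = [:0, 0, 1:]"
proof -
  have "c22 2 0 = 0" "c22 2 1 = 0"
    by (simp_all add: c22_def f22_def)
  moreover have "c22 2 2 = 1"
    using c22_eq_f22[of 2 0 0 2] by (simp add: f22_0)
  ultimately show ?thesis
    by (simp add: P22_def numeral_2_eq_2 monom_0 monom_Suc)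
qed

lemma P22_3: "P22 3 = [:0, -2, 0, 2:]"
proof -
  have "c22 3 0 = 0" "c22 3 2 = 0"
    by (simp_all add: c22_def)
  moreover have "c22 3 1 = -2"
    using c22_eq_f22[of 3 0 1 1] by (simp add: f22_0[simplified])
  moreover have "c22 3 3 = 2"
    using c22_eq_f22[of 3 1 0 3] f22_rec_0[of 0] by (simp add: f22_0)
  ultimately show ?thesis
    by (simp add: P22_def numeral_3_eq_3 numeral_2_eq_2 monom_0 monom_Suc)
qed

lemma P22_4: "P22 4 = [:1, 0, -5, 0, 4:]"
proof -
  have "c22 4 1 = 0" "c22 4 3 = 0"
    by (simp_all add: c22_def)
  moreover have "c22 4 0 = 1"
    using c22_eq_f22[of 4 0 2 0] by (simp add: f22_0)
  moreover have "c22 4 2 = -5"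
    using c22_eq_f22[of 4 1 1 2] f22_rec[of 0 0] by (simp add: f22_0[simplified])
  moreover have "c22 4 4 = 4"
    using c22_eq_f22[of 4 2 0 4] f22_rec_0[of 1] f22_rec_0[of 0] by (simp add: f22_0)
  ultimately show ?thesis
    by (simp add: P22_def eval_nat_numeral monom_0 monom_Suc)
qed

lemma cos_add_2: "cos ((r + 2) * t) = 2 * cos t * cos ((r + 1) * t) - cos (r * t :: real)"
proof -
  have "cos ((r + 1) * t + t) + cos ((r + 1) * t - t) = 2 * cos t * cos ((r + 1) * t)"
    by (simp add: cos_add cos_diff)
  thus ?thesis by (simp add: algebra_simps)
qed

text \<open>Both sides satisfy the recurrence of \<open>cos_add_2\<close>; since it is available for the
  polynomials from index \<open>3\<close> on, the initial values are \<open>P\<^sub>3\<close> and \<open>P\<^sub>4\<close>.\<close>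

lemma poly_P22_cos_ge_3:
  "poly (P22 (j + 3)) (cos t) = (cos ((real j + 3) * t) - cos ((real j + 1) * t)) / 2"
proof (induction j rule: induct_nat_012)
  case 0
  have "cos (3 * t) = 2 * cos t * (2 * cos t * cos t - 1) - cos t"
    using cos_add_2[of 1 t] cos_add_2[of 0 t] by simp
  thus ?case
    by (simp add: P22_3 algebra_simps)
next
  case 1
  have c2: "cos (2 * t) = 2 * cos t * cos t - 1"
    using cos_add_2[of 0 t] by simp
  have c3: "cos (3 * t) = 2 * cos t * cos (2 * t) - cos t"
    using cos_add_2[of 1 t] by simp
  have "cos (4 * t) = 2 * cos t * (2 * cos t * (2 * cos t * cos t - 1) - cos t)
      - (2 * cos t * cos t - 1)"
    using cos_add_2[of 2 t] by (simp add: c3[unfolded c2] c2)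
  with c2 show ?case
    by (simp add: P22_4 algebra_simps)
next
  case (ge2 j)
  have "poly (P22 (Suc (Suc j) + 3)) (cos t) =
      2 * cos t * poly (P22 (Suc j + 3)) (cos t) - poly (P22 (j + 3)) (cos t)"
    using P22_rec[of "j + 3"] by simp
  also have "\<dots> = (cos ((real j + 5) * t) - cos ((real j + 3) * t)) / 2"
    using cos_add_2[of "real j + 3" t] cos_add_2[of "real j + 1" t]
    by (simp only: ge2) (simp add: field_simps)
  finally show ?case
    by (simp add: algebra_simps)
qed

lemma poly_P22_cos:
  assumes "n \<ge> 2"
  shows "poly (P22 n) (cos t) =
    (cos (real n * t) + (if n = 2 then 1 else -1) * cos (real (n - 2) * t)) / 2"
proof (cases "n = 2")
  case True
  thus ?thesis
    using cos_double_cos[of t] by (simp add: P22_2 power2_eq_square)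
next
  case False
  with assms have "n \<ge> 3" by simp
  then obtain j where "n = j + 3"
    by (metis add.commute le_add_diff_inverse)
  thus ?thesis
    using poly_P22_cos_ge_3[of j t] by (simp add: algebra_simps)
qed

section \<open>Integrals with the Chebyshev weight\<close>

text \<open>The function \<open>- G (arccos x)\<close> is an antiderivative of the integrand on the open interval
  and is continuous up to the endpoints, so the singularities of the weight do no harm.\<close>

lemma has_integral_arccos_substitution:
  assumes G: "\<And>t. t \<in> {0..pi} \<Longrightarrow> (G has_real_derivative g t) (at t)"
  shows "((\<lambda>x. g (arccos x) / sqrt (1 - x\<^sup>2)) has_integral (G pi - G 0)) {-1..1}"
proof -
  have "((\<lambda>x. g (arccos x) / sqrt (1 - x\<^sup>2)) has_integral
      (- G (arccos 1) - (- G (arccos (- 1))))) {-1..1}"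
  proof (rule fundamental_theorem_of_calculus_interior)
    have "continuous_on {0..pi} G"
      using G by (meson DERIV_continuous continuous_at_imp_continuous_on)
    moreover have "continuous_on {-1..1} arccos"
      by (rule continuous_on_arccos')
    moreover have "arccos ` {-1..1} \<subseteq> {0..pi}"
      using arccos_bounded by auto
    ultimately show "continuous_on {-1..1} (\<lambda>x. - G (arccos x))"
      by (rule continuous_on_minus[OF continuous_on_compose2])
  next
    fix x :: real assume x: "x \<in> {-1<..<1}"
    hence "arccos x \<in> {0..pi}"
      using arccos_bounded[of x] by auto
    from DERIV_minus[OF DERIV_chain2[OF G[OF this] DERIV_arccos]] x
    have "((\<lambda>x. - G (arccos x)) has_real_derivative
        - (g (arccos x) * inverse (- sqrt (1 - x\<^sup>2)))) (at x)"
      by simp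
    thus "((\<lambda>x. - G (arccos x)) has_vector_derivative g (arccos x) / sqrt (1 - x\<^sup>2)) (at x)"
      by (simp add: has_real_derivative_iff_has_vector_derivative[symmetric] field_simps)
  qed simp
  thus ?thesis by simp
qed

text \<open>An integer frequency lets the product-to-sum formula be applied to \<open>cos (a t) cos (b t)\<close>
  without distinguishing the order of \<open>a\<close> and \<open>b\<close>.\<close>

lemma has_integral_cos_int_arccos:
  "((\<lambda>x. cos (real_of_int j * arccos x) / sqrt (1 - x\<^sup>2)) has_integral
     (if j = 0 then pi else 0)) {-1..1}"
proof (cases "j = 0")
  case True
  show ?thesis
    using has_integral_arccos_substitution[of "\<lambda>t. t" "\<lambda>t. 1"] True by simp
next
  case False
  have "((\<lambda>t. sin (real_of_int j * t) / j) has_real_derivative cos (real_of_int j * t)) (at t)" for t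
    using False by (auto intro!: derivative_eq_intros)
  from has_integral_arccos_substitution[of _ "\<lambda>t. cos (real_of_int j * t)", OF this]
  show ?thesis
    using False by (simp add: mult.commute[of "real_of_int j" pi])
qed

text \<open>The orthogonality of the Chebyshev polynomials \<open>T\<^sub>a(x) = cos (a arccos x)\<close>.\<close>

lemma has_integral_cos_cos_arccos:
  fixes a b :: nat
  shows "((\<lambda>x. cos (real a * arccos x) * cos (real b * arccos x) / sqrt (1 - x\<^sup>2)) has_integral
     (if a = b then if a = 0 then pi else pi / 2 else 0)) {-1..1}"
proof -
  have "((\<lambda>x. (1 / 2) * (cos (real_of_int (int a - int b) * arccos x) / sqrt (1 - x\<^sup>2) +
        cos (real_of_int (int a + int b) * arccos x) / sqrt (1 - x\<^sup>2))) has_integral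
      (1 / 2) * ((if int a - int b = 0 then pi else 0) + (if int a + int b = 0 then pi else 0)))
      {-1..1}"
    by (intro has_integral_mult_right has_integral_add has_integral_cos_int_arccos)
  also have "(\<lambda>x. (1 / 2) * (cos (real_of_int (int a - int b) * arccos x) / sqrt (1 - x\<^sup>2) +
        cos (real_of_int (int a + int b) * arccos x) / sqrt (1 - x\<^sup>2))) =
      (\<lambda>x. cos (real a * arccos x) * cos (real b * arccos x) / sqrt (1 - x\<^sup>2))"
    by (simp add: cos_times_cos add_divide_distrib ring_distribs)
  finally show ?thesis
    by (rule back_subst[where P = "\<lambda>I. (_ has_integral I) _"]) auto
qed

theorem theorem3p1:
  fixes n m :: nat
  assumes "n \<ge> 2" and "m \<ge> 2"
  shows "((\<lambda>x::real. poly (P22 n) x * poly (P22 m) x / sqrt (1 - x\<^sup>2)) has_integral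
     (if n = 2 \<and> m = 2 then 3 * pi / 8
      else if m = n then pi / 4
      else if \<bar>int n - int m\<bar> = 2 then - pi / 8
      else 0)) {-1..1}"
proof -
  \<comment> \<open>\<open>P\<^sub>n = (T\<^sub>n + e n T\<^bsub>n-2\<^esub>) / 2\<close>, and \<open>I a b\<close> is the integral of the weighted product
    \<open>C a b\<close> of \<open>T\<^sub>a\<close> and \<open>T\<^sub>b\<close>.\<close>
  define e :: "nat \<Rightarrow> real" where "e = (\<lambda>n. if n = 2 then 1 else -1)"
  define I :: "nat \<Rightarrow> nat \<Rightarrow> real"
    where "I = (\<lambda>a b. if a = b then if a = 0 then pi else pi / 2 else 0)"
  define C :: "nat \<Rightarrow> nat \<Rightarrow> real \<Rightarrow> real"
    where "C = (\<lambda>a b x. cos (real a * arccos x) * cos (real b * arccos x) / sqrt (1 - x\<^sup>2))"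
  have C: "(C a b has_integral I a b) {-1..1}" for a b
    unfolding C_def I_def by (rule has_integral_cos_cos_arccos)
  have "((\<lambda>x. (1 / 4) * (C n m x + e m * C n (m - 2) x
          + e n * C (n - 2) m x + e n * e m * C (n - 2) (m - 2) x)) has_integral
      (1 / 4) * (I n m + e m * I n (m - 2) + e n * I (n - 2) m + e n * e m * I (n - 2) (m - 2)))
      {-1..1}"
    by (intro has_integral_mult_right has_integral_add C)
  also have "(1 / 4) * (I n m + e m * I n (m - 2) + e n * I (n - 2) m
        + e n * e m * I (n - 2) (m - 2)) =
      (if n = 2 \<and> m = 2 then 3 * pi / 8
      else if m = n then pi / 4
      else if \<bar>int n - int m\<bar> = 2 then - pi / 8
      else 0)"
  proof -
    from assms obtain p q where pq: "n = p + 2" "m = q + 2"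
      by (metis add.commute le_add_diff_inverse)
    consider "p = q" | "p = q + 2" | "q = p + 2" | "p \<noteq> q" "p \<noteq> q + 2" "q \<noteq> p + 2"
      by blast
    thus ?thesis
    proof cases
      case 1
      thus ?thesis by (cases "q = 0") (simp_all add: pq I_def e_def)
    next
      case 2
      thus ?thesis by (simp add: pq I_def e_def)
    next
      case 3
      thus ?thesis by (simp add: pq I_def e_def)
    next
      case 4
      hence "\<bar>int p - int q\<bar> \<noteq> 2" by linarith
      with 4 show ?thesis by (auto simp: pq I_def)
    qed
  qed
  finally show ?thesis
  proof (rule has_integral_eq[rotated])
    fix x :: real assume "x \<in> {-1..1}"
    hence x: "x = cos (arccos x)" by simp
    have "poly (P22 k) x = (cos (real k * arccos x) + e k * cos (real (k - 2) * arccos x)) / 2"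
      if "k \<ge> 2" for k
      by (subst x, subst poly_P22_cos[OF that]) (simp add: e_def)
    from this[OF assms(1)] this[OF assms(2)]
    show "(1 / 4) * (C n m x + e m * C n (m - 2) x + e n * C (n - 2) m x
          + e n * e m * C (n - 2) (m - 2) x) =
        poly (P22 n) x * poly (P22 m) x / sqrt (1 - x\<^sup>2)"
      by (simp add: C_def algebra_simps add_divide_distrib)
  qed
qed

end
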